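(* For every integer $N\ge0$, \[\det\left[\frac{(2i+1)\,(2(i+j))!}{j!\,(2i+j+1)!}\right]_{0\le i,j\le N}=2^{\frac{N(N+1)}{2}}.\] *)

theory Defs
  imports "Jordan_Normal_Form.Determinant"
begin

end

theory Submission
  imports Defs "HOL-Computational_Algebra.Formal_Power_Series"
begin

text \<open>
  Row \<open>i\<close> of the matrix lists the coefficients of \<open>C ^ (2 * i + 1) = C * (C\<^sup>2) ^ i\<close>, where
  \<open>C = 1 + X * C\<^sup>2\<close> is the generating function of the Catalan numbers. Expanding
  \<open>(C\<^sup>2) ^ i = (1 + (C\<^sup>2 - 1)) ^ i\<close> by the binomial theorem factors the matrix as the unitriangular
  Pascal matrix times the matrix of coefficients of \<open>C * (C\<^sup>2 - 1) ^ k\<close>. The latter is upper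
  triangular with diagonal entries \<open>2 ^ k\<close>, because \<open>C\<^sup>2 - 1 = 2 * X + \<dots>\<close>.
\<close>

no_notation vec_index (infixl "$" 100)
unbundle fps_syntax

text \<open>The constant coefficient is split off because the general formula fails at \<open>r = n = 0\<close>.\<close>

definition catalan_pow :: "nat \<Rightarrow> 'a :: field_char_0 fps" where
  "catalan_pow r = Abs_fps (\<lambda>n. if n = 0 then 1
     else of_nat r * fact (2 * n + r - 1) / (fact n * fact (n + r)))"

lemma catalan_pow_nth_0 [simp]: "catalan_pow r $ 0 = 1"
  by (simp add: catalan_pow_def)

lemma catalan_pow_nth_Suc:
  "catalan_pow r $ Suc n = of_nat r * fact (2 * n + r + 1) / (fact (Suc n) * fact (n + r + 1))"
  by (simp add: catalan_pow_def)

lemma catalan_pow_nth: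
  assumes "r > 0"
  shows "catalan_pow r $ n = of_nat r * fact (2 * n + r - 1) / (fact n * fact (n + r))"
  using assms by (cases r) (simp_all add: catalan_pow_def del: of_nat_Suc)

lemma catalan_pow_0 [simp]: "catalan_pow 0 = 1"
  by (rule fps_ext) (simp add: catalan_pow_def)

text \<open>This is \<open>C = 1 + X * C\<^sup>2\<close> multiplied by \<open>C ^ r\<close> and read
  off coefficientwise; it is checked on the closed forms, before these are known to be
  powers.\<close>

lemma catalan_pow_Suc_nth_Suc:
  "catalan_pow (Suc r) $ Suc n =
     catalan_pow r $ Suc n + (catalan_pow (Suc (Suc r)) $ n :: 'a :: field_char_0)"
proof -
  define F G H :: 'a where "F = fact n" and "G = fact (n + r + 1)" and "H = fact (2 * n + r + 1)"
  have "F \<noteq> 0" "G \<noteq> 0"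
    unfolding F_def G_def by (rule fact_nonzero)+
  moreover have "(of_nat n + 1 :: 'a) \<noteq> 0" "(of_nat n + of_nat r + 2 :: 'a) \<noteq> 0"
    using of_nat_neq_0[of n, where ?'a = 'a] of_nat_neq_0[of "n + r + 1", where ?'a = 'a]
    by (simp_all add: algebra_simps)
  ultimately have nonzero: "F \<noteq> 0" "G \<noteq> 0" "(of_nat n + 1 :: 'a) \<noteq> 0"
      "(of_nat n + of_nat r + 2 :: 'a) \<noteq> 0"
    by auto
  have 1: "catalan_pow (Suc r) $ Suc n =
      (of_nat r + 1) * ((2 * of_nat n + of_nat r + 2) * H) /
      ((of_nat n + 1) * F * ((of_nat n + of_nat r + 2) * G))"
    by (simp add: catalan_pow_nth_Suc F_def G_def H_def algebra_simps)
  have 2: "catalan_pow r $ Suc n = of_nat r * H / ((of_nat n + 1) * F * G)"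
    by (simp add: catalan_pow_nth_Suc F_def G_def H_def algebra_simps)
  have 3: "catalan_pow (Suc (Suc r)) $ n =
      (of_nat r + 2) * H / (F * ((of_nat n + of_nat r + 2) * G))"
    by (simp add: catalan_pow_nth F_def G_def H_def algebra_simps)
  \<comment> \<open>Over a common denominator, what remains is
    \<open>(r+1)(2n+r+2) = r(n+r+2) + (r+2)(n+1)\<close>.\<close>
  show ?thesis
    unfolding 1 2 3 using nonzero by (simp add: divide_simps) (simp add: algebra_simps)
qed

lemma catalan_pow_rec:
  "catalan_pow (Suc r) = catalan_pow r + fps_X * catalan_pow (Suc (Suc r))"
proof (rule fps_ext)
  fix n
  show "catalan_pow (Suc r) $ n = (catalan_pow r + fps_X * catalan_pow (Suc (Suc r))) $ n"
    by (cases n) (simp_all add: catalan_pow_Suc_nth_Suc)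
qed

text \<open>The recurrence determines the coefficients of order \<open>n\<close> from those of order \<open>n - 1\<close>.\<close>

lemma fps_rec_eq_0:
  fixes G :: "nat \<Rightarrow> 'a :: comm_ring_1 fps"
  assumes "G 0 = 0" and rec: "\<And>r. G (Suc r) = G r + fps_X * G (Suc (Suc r))"
  shows "G r = 0"
proof -
  have "G r $ n = 0" for r n
  \<comment> \<open>The recurrence raises the index while lowering the order, so the outer
    hypothesis must cover every index. The inner induction starts from
    \<open>G 0 = 0\<close>.\<close>
  proof (induction n arbitrary: r)
    case 0
    show ?case
    proof (induction r)
      case (Suc r)
      then show ?case by (subst rec) simp
    qed (simp add: assms(1))
  next
    case (Suc n)
    show ?case
    proof (induction r)
      case (Suc r)
      then show ?case by (subst rec) (simp add: \<open>\<And>r. G r $ n = 0\<close>)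
    qed (simp add: assms(1))
  qed
  then show ?thesis by (simp add: fps_eq_iff)
qed

text \<open>Both sides satisfy the same linear recurrence in \<open>r\<close> and agree at
  \<open>r = 0\<close>, so their difference vanishes. No convolution of coefficients has to be
  evaluated.\<close>

lemma catalan_pow_Suc: "catalan_pow (Suc r) = catalan_pow 1 * catalan_pow r"
proof -
  define G :: "nat \<Rightarrow> 'a fps" where "G r = catalan_pow (Suc r) - catalan_pow 1 * catalan_pow r" for r
  have "G (Suc r) = G r + fps_X * G (Suc (Suc r))" for r
  proof -
    \<comment> \<open>The recurrence is folded, at \<open>r + 1\<close> and at \<open>r\<close>;
      unfolding it would loop.\<close>
    have "G (Suc r) = (catalan_pow (Suc r) + fps_X * catalan_pow (Suc (Suc (Suc r))))
        - catalan_pow 1 * (catalan_pow r + fps_X * catalan_pow (Suc (Suc r)))"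
      by (simp only: G_def flip: catalan_pow_rec)
    then show ?thesis
      by (simp add: G_def algebra_simps)
  qed
  then have "G r = 0"
    by (rule fps_rec_eq_0[rotated]) (simp add: G_def)
  then show ?thesis
    by (simp add: G_def)
qed

lemma catalan_pow_eq_power: "catalan_pow r = catalan_pow 1 ^ r"
  by (induction r) (simp_all only: catalan_pow_0 power_0 catalan_pow_Suc power_Suc)

text \<open>Since \<open>fps_X\<close> divides \<open>g\<close>, a factor \<open>fps_X ^ k\<close>
  splits off from \<open>g ^ k\<close>.\<close>

lemma nth_mult_power_subdegree:
  fixes f g :: "'a :: comm_ring_1 fps"
  assumes "g $ 0 = 0"
  shows "j < k \<Longrightarrow> (f * g ^ k) $ j = 0"
    and "(f * g ^ k) $ k = f $ 0 * (g $ 1) ^ k"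
proof -
  define D where "D = fps_shift 1 g"
  have "g = fps_X * D"
    by (rule fps_ext) (simp add: D_def assms)
  then have *: "f * g ^ k = fps_X ^ k * (f * D ^ k)"
    by (simp add: power_mult_distrib ac_simps)
  show "j < k \<Longrightarrow> (f * g ^ k) $ j = 0"
    unfolding * by (simp add: fps_X_power_mult_nth)
  show "(f * g ^ k) $ k = f $ 0 * (g $ 1) ^ k"
    unfolding * by (simp add: fps_X_power_mult_nth fps_nth_power_0 D_def)
qed

lemma det_mult_power_coeffs:
  fixes f g :: "'a :: idom fps"
  assumes "g $ 0 = 1"
  shows "det (mat n n (\<lambda>(i, j). (f * g ^ i) $ j)) = (f $ 0) ^ n * (g $ 1) ^ (\<Sum>i<n. i)"
proof -
  define L :: "'a mat" where "L = mat n n (\<lambda>(i, k). of_nat (i choose k))"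
  define U :: "'a mat" where "U = mat n n (\<lambda>(k, j). (f * (g - 1) ^ k) $ j)"
  have g1: "(g - 1) $ 0 = 0"
    using assms by simp
  have "mat n n (\<lambda>(i, j). (f * g ^ i) $ j) = L * U"
  proof (rule eq_matI)
    fix i j
    assume "i < dim_row (L * U)" "j < dim_col (L * U)"
    then have ij: "i < n" "j < n"
      by (simp_all add: L_def U_def)
    have "f * g ^ i = f * ((g - 1) + 1) ^ i"
      by simp
    also have "\<dots> = (\<Sum>k\<le>i. of_nat (i choose k) * (f * (g - 1) ^ k))"
      by (subst binomial_ring) (simp add: sum_distrib_left mult_ac)
    \<comment> \<open>The added terms have \<open>k > i\<close>, hence binomial coefficient 0; the
      range now fits the matrix product.\<close>
    also have "\<dots> = (\<Sum>k<n. of_nat (i choose k) * (f * (g - 1) ^ k))"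
      using ij by (intro sum.mono_neutral_left) (auto simp: binomial_eq_0)
    finally have "(f * g ^ i) $ j = (\<Sum>k<n. of_nat (i choose k) * (f * (g - 1) ^ k) $ j)"
      by (simp add: fps_sum_nth fps_mult_left_const_nth flip: fps_of_nat)
    with ij show "mat n n (\<lambda>(i, j). (f * g ^ i) $ j) $$ (i, j) = (L * U) $$ (i, j)"
      by (simp add: L_def U_def scalar_prod_def lessThan_atLeast0)
  qed (simp_all add: L_def U_def)
  moreover have "det L = 1"
  proof -
    have "det L = prod_list (diag_mat L)"
      by (rule det_lower_triangular[of n]) (simp_all add: L_def binomial_eq_0)
    also have "\<dots> = 1"
      by (simp add: prod_list_diag_prod L_def)
    finally show ?thesis .
  qed
  moreover have "det U = (f $ 0) ^ n * (g $ 1) ^ (\<Sum>i<n. i)"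
  proof -
    have "det U = prod_list (diag_mat U)"
      by (rule det_upper_triangular[of _ n])
        (auto simp: U_def upper_triangular_def nth_mult_power_subdegree(1)[OF g1])
    also have "\<dots> = (\<Prod>i<n. f $ 0 * (g $ 1) ^ i)"
      by (simp add: prod_list_diag_prod U_def nth_mult_power_subdegree(2)[OF g1] lessThan_atLeast0)
    also have "\<dots> = (f $ 0) ^ n * (g $ 1) ^ (\<Sum>i<n. i)"
      by (simp add: prod.distrib power_sum)
    finally show ?thesis .
  qed
  moreover have "det (L * U) = det L * det U"
    by (rule det_mult[of _ n]) (simp_all add: L_def U_def)
  ultimately show ?thesis
    by (simp only: mult_1)
qed

theorem theorem8p1:
  fixes N :: nat
  shows "det (mat (N + 1) (N + 1)
           (\<lambda>(i, j). (of_nat (2 * i + 1) * fact (2 * (i + j))) / (fact j * fact (2 * i + j + 1)) :: rat))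
         = 2 ^ (N * (N + 1) div 2)"
proof -
  have entry: "of_nat (2 * i + 1) * fact (2 * (i + j)) / (fact j * fact (2 * i + j + 1)) =
      (catalan_pow 1 * catalan_pow 2 ^ i :: rat fps) $ j" for i j
  proof -
    have "(catalan_pow 1 * catalan_pow 2 ^ i :: rat fps) = catalan_pow (2 * i + 1)"
      unfolding catalan_pow_eq_power[of 2] catalan_pow_eq_power[of "2 * i + 1"]
      by (simp add: power_mult)
    then show ?thesis
      \<comment> \<open>The index \<open>2 * i + 1\<close> is positive, so the closed form also
        covers \<open>j = 0\<close>.\<close>
      by (simp add: catalan_pow_nth algebra_simps)
  qed
  have slope: "(catalan_pow 2 :: rat fps) $ 1 = 2"
    by (simp add: catalan_pow_def fact_numeral)
  have exponent: "(\<Sum>i<N + 1. i) = N * (N + 1) div 2"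
    using gauss_sum_nat[of N] by (simp add: atLeast0AtMost lessThan_Suc_atMost)
  show ?thesis
    unfolding entry det_mult_power_coeffs[OF catalan_pow_nth_0] slope exponent
      catalan_pow_nth_0 power_one mult_1 ..
qed

end
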